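(* Let $\pi$ be a permutation of $q\ge 2$ symbols and let $F_\pi:I\to I$ be the corresponding rotated odometer on $I=[0,1)$. There exists a decomposition $I = I_{per} \cup I_{np}$ (into disjoint sets) with the following properties: (1) Every point in $I_{per}$ is periodic, and the restriction $F_\pi: I_{per} \to I_{per}$ is well-defined and invertible. (2) If $I_{per}$ is non-empty, then $I_{per}$ is a (possibly infinite) union of half-open intervals $[x,y)$. (3) The set $I_{np}$ contains $0$, and $F_\pi: I_{np} \to I_{np}$ is well-defined and invertible at every point except $0$. (4) There is a unique minimal subsystem $(I_{min}, F_\pi)$ of $(I_{np}, F_\pi)$, and $0 \in I_{min}$.
   Context: Let $I=[0,1)$. The von Neumann–Kakutani map $\mathfrak a: I\to I$ is $\mathfrak a(x)=x-(1-3\cdot 2^{-n})$ for $x\in[1-2^{1-n},1-2^{-n})$, $n\ge 1$. For a permutation $\pi$ of $\{0,\dots,q-1\}$, $R_\pi:I\to I$ maps each interval $[\frac iq,\frac{i+1}q)$ by a translation onto $[\frac{\pi(i)}q,\frac{\pi(i)+1}q)$. The rotated odometer is $F_\pi=\mathfrak a\circ R_\pi$. $I_{per}$ is the set of points $x\in I$ with periodic orbit ($F_\pi^n(x)=x$ for some $n\geq 1$), and $I_{np}=I\setminus I_{per}$. "Invertible at every point except $0$" means that every point other than $0$ has exactly one preimage. A minimal subsystem of $(I_{np},F_\pi)$ is given by a non-empty subset $M\subset I_{np}$, closed in $I_{np}$, with $F_\pi(M)\subset M$, having no proper subset with the same properties. *)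

theory Defs
  imports "HOL-Analysis.Analysis" "HOL-Combinatorics.Permutations"
begin

text \<open>The phase space is \<open>I = {0..<1}\<close>. All maps are total functions on the reals; their values
  outside \<open>{0..<1}\<close> are irrelevant.\<close>

text \<open>For \<open>x \<in> {0..<1}\<close>, the index \<open>n \<ge> 1\<close> with \<open>x \<in> [1 - 2^(1-n), 1 - 2^(-n))\<close>.\<close>

definition vnk_index :: "real \<Rightarrow> nat" where
  "vnk_index x = (THE n. n \<ge> 1 \<and> x \<in> {1 - 2 / 2 ^ n ..< 1 - 1 / 2 ^ n})"

definition von_neumann_kakutani :: "real \<Rightarrow> real" where
  "von_neumann_kakutani x = x - (1 - 3 / 2 ^ vnk_index x)"

definition interval_perm :: "nat \<Rightarrow> (nat \<Rightarrow> nat) \<Rightarrow> real \<Rightarrow> real" where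
  "interval_perm q \<pi> x =
     (let i = nat \<lfloor>real q * x\<rfloor> in x + (real (\<pi> i) - real i) / real q)"

definition rotated_odometer :: "nat \<Rightarrow> (nat \<Rightarrow> nat) \<Rightarrow> real \<Rightarrow> real" where
  "rotated_odometer q \<pi> = von_neumann_kakutani \<circ> interval_perm q \<pi>"

definition I_per :: "nat \<Rightarrow> (nat \<Rightarrow> nat) \<Rightarrow> real set" where
  "I_per q \<pi> = {x \<in> {0..<1}. \<exists>n\<ge>1. (rotated_odometer q \<pi> ^^ n) x = x}"

definition I_np :: "nat \<Rightarrow> (nat \<Rightarrow> nat) \<Rightarrow> real set" where
  "I_np q \<pi> = {0..<1} - I_per q \<pi>"

definition subsystem :: "'a::topological_space set \<Rightarrow> ('a \<Rightarrow> 'a) \<Rightarrow> 'a set \<Rightarrow> bool" where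
  "subsystem X f M \<longleftrightarrow> M \<noteq> {} \<and> M \<subseteq> X \<and> closedin (top_of_set X) M \<and> f ` M \<subseteq> M"

definition minimal_subsystem :: "'a::topological_space set \<Rightarrow> ('a \<Rightarrow> 'a) \<Rightarrow> 'a set \<Rightarrow> bool" where
  "minimal_subsystem X f M \<longleftrightarrow> subsystem X f M \<and> (\<forall>N. N \<subset> M \<longrightarrow> \<not> subsystem X f N)"

lemma vnk_index_eq:
  assumes "n \<ge> 1" "x \<in> {1 - 2 / 2 ^ n ..< 1 - 1 / 2 ^ n}"
  shows "vnk_index x = n"
  unfolding vnk_index_def
proof (rule the_equality)
  show "n \<ge> 1 \<and> x \<in> {1 - 2 / 2 ^ n ..< 1 - 1 / 2 ^ n}" using assms by blast
next
  fix m :: nat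
  assume m: "m \<ge> 1 \<and> x \<in> {1 - 2 / 2 ^ m ..< 1 - 1 / 2 ^ m}"
  have *: "\<not> a < b" if "1 - 2 / 2 ^ b \<le> x" "x < 1 - 1 / 2 ^ a" for a b :: nat
  proof
    assume "a < b"
    then have "(2::real) ^ Suc a \<le> 2 ^ b" by (intro power_increasing) auto
    then have "2 / 2 ^ b \<le> 1 / (2::real) ^ a" by (simp add: field_simps)
    with that show False by linarith
  qed
  from *[of m n] *[of n m] m assms show "m = n" by auto
qed

lemma von_neumann_kakutani_eq:
  assumes "n \<ge> 1" "x \<in> {1 - 2 / 2 ^ n ..< 1 - 1 / 2 ^ n}"
  shows "von_neumann_kakutani x = x - (1 - 3 / 2 ^ n)"
  using vnk_index_eq[OF assms] by (simp add: von_neumann_kakutani_def)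

lemma interval_perm_eq:
  assumes "i < q" "x \<in> {real i / real q ..< (real i + 1) / real q}"
  shows "interval_perm q \<pi> x = x + (real (\<pi> i) / real q - real i / real q)"
proof -
  have "\<lfloor>real q * x\<rfloor> = int i"
    using assms by (intro floor_unique) (auto simp: field_simps)
  then show ?thesis by (simp add: interval_perm_def diff_divide_distrib)
qed

end

theory Submission
  imports Defs
begin

text \<open>
  The map \<open>von_neumann_kakutani\<close> translates the \<open>n\<close>-th interval of the partition of \<open>{0..<1}\<close>
  that accumulates at \<open>1\<close> onto \<open>{1/2^n ..< 2/2^n}\<close>. These image intervals tile \<open>{0<..<1}\<close>, so
  the rotated odometer \<open>F\<close> is a bijection from \<open>{0..<1}\<close> onto \<open>{0<..<1}\<close>: it is injective, and
  \<open>0\<close> is the only point without a preimage. Everything about bijectivity on the periodic and the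
  non-periodic part is a formal consequence, and \<open>0\<close> is not periodic because it is not in the
  range.

  All pieces of \<open>F\<close> are half-open on the right, so every iterate of \<open>F\<close> is a translation on some
  \<open>{x..<x + e}\<close>. If the iterate fixes \<open>x\<close>, this translation is trivial. Hence every periodic point
  is the left end point of an interval of periodic points.

  The minimal subsystem rests on one observation (\<open>nonperiodic_orbit_near_0\<close>): the forward orbit of
  a non-periodic point comes arbitrarily close to \<open>0\<close>. The short pieces of \<open>F\<close> have their images
  near \<open>0\<close>, so an orbit that stays in \<open>{1/2^N..<1}\<close> meets only finitely many pieces, and each of
  its steps translates by a multiple of \<open>1/(q 2^N)\<close>. Such an orbit runs through a bounded part of
  a translated lattice, so it is finite, and a finite orbit of an injective map is periodic.
  Since a subsystem is closed in the non-periodic part, which contains \<open>0\<close>, it follows that every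
  subsystem contains \<open>0\<close>. The intersection of all subsystems is then non-empty, hence itself a
  subsystem, and it is the unique minimal one.
\<close>

section \<open>Periodic points of injective self-maps\<close>

lemma funpow_in_set:
  assumes "f ` S \<subseteq> S" "x \<in> S"
  shows "(f ^^ n) x \<in> S"
  using assms by (induction n) auto

lemma inj_on_funpow:
  assumes "inj_on f S" "f ` S \<subseteq> S"
  shows "inj_on (f ^^ n) S"
proof (induction n)
  case (Suc n)
  have "inj_on f ((f ^^ n) ` S)"
    using assms funpow_in_set[of f S] by (meson image_subsetI inj_on_subset)
  from comp_inj_on[OF Suc this] show ?case by (simp only: funpow.simps)
qed simp

text \<open>A finite orbit repeats a value, and injectivity of the iterates cancels the part of the orbit
  before the repetition, so that the orbit returns to its very start.\<close>

lemma periodic_if_finite_orbit: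
  assumes inj: "inj_on f S" and maps: "f ` S \<subseteq> S" and x: "x \<in> S"
    and fin: "finite (range (\<lambda>n. (f ^^ n) x))"
  shows "\<exists>n\<ge>1. (f ^^ n) x = x"
proof -
  have "\<not> inj (\<lambda>n. (f ^^ n) x)"
    using fin finite_imageD infinite_UNIV_nat by blast
  then obtain i j where "i < j" and eq: "(f ^^ i) x = (f ^^ j) x"
    by (metis injI linorder_neqE_nat)
  then have "(f ^^ i) ((f ^^ (j - i)) x) = (f ^^ i) x"
    by (metis funpow_add le_add_diff_inverse less_imp_le_nat o_apply)
  then have "(f ^^ (j - i)) x = x"
    using inj_on_funpow[OF inj maps] funpow_in_set[OF maps x] x by (meson inj_onD)
  then show ?thesis using \<open>i < j\<close> by (intro exI[of _ "j - i"]) auto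
qed

text \<open>Read from right to left this keeps the periodic points invariant; from left to right it keeps the
  non-periodic points invariant, which depends on injectivity.\<close>

lemma periodic_image_iff:
  assumes inj: "inj_on f S" and maps: "f ` S \<subseteq> S" and x: "x \<in> S"
  shows "(f ^^ n) (f x) = f x \<longleftrightarrow> (f ^^ n) x = x"
  using inj_onD[OF inj _ funpow_in_set[OF maps x] x] by (metis funpow_swap1)

lemma bij_betw_periodic_points:
  assumes inj: "inj_on f S" and maps: "f ` S \<subseteq> S"
  defines "P \<equiv> {x \<in> S. \<exists>n\<ge>1. (f ^^ n) x = x}"
  shows "bij_betw f P P"
  unfolding bij_betw_def
proof
  show "inj_on f P" using inj by (rule inj_on_subset) (auto simp: P_def)
  have "f x \<in> P" if "x \<in> P" for x
    using that maps periodic_image_iff[OF inj maps] by (fastforce simp: P_def)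
  moreover have "x \<in> f ` P" if x: "x \<in> P" for x
  proof -
    \<comment> \<open>The preimage is found one step before the orbit returns to its start.\<close>
    obtain n where n: "n \<ge> 1" "(f ^^ n) x = x" using x by (auto simp: P_def)
    define z where "z = (f ^^ (n - 1)) x"
    have fz: "f z = x" using n by (cases n) (auto simp: z_def)
    have z: "z \<in> S" using x funpow_in_set[OF maps] by (auto simp: z_def P_def)
    then have "(f ^^ n) z = z" using n periodic_image_iff[OF inj maps z, of n] fz by simp
    with n z have "z \<in> P" by (auto simp: P_def)
    with fz show ?thesis by blast
  qed
  ultimately show "f ` P = P" by blast
qed

section \<open>Bijectivity of the rotated odometer\<close>

text \<open>The next two lemmas say that the intervals \<open>{1/2^n ..< 2/2^n}\<close> for \<open>n \<ge> 1\<close> tile \<open>{0<..<1}\<close>.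
  Level \<open>0\<close> occurs only for \<open>y = 1\<close>.\<close>

lemma dyadic_level_below:
  fixes y :: real
  assumes "0 < y" "y \<le> 1"
  shows "\<exists>n. 1 / 2 ^ n \<le> y \<and> (n = 0 \<or> y < 2 / 2 ^ n)"
proof -
  define n where "n = (LEAST n. 1 / 2 ^ n \<le> y)"
  have "\<exists>n. 1 / 2 ^ n \<le> y"
    using real_arch_pow_inv[OF assms(1), of "1/2"] by (auto simp: power_divide intro: less_imp_le)
  then have "1 / 2 ^ n \<le> y" unfolding n_def by (rule LeastI_ex)
  moreover have "y < 2 / 2 ^ n" if "n \<noteq> 0"
  proof -
    have "\<not> 1 / 2 ^ (n - 1) \<le> y"
      unfolding n_def by (rule not_less_Least) (use that in \<open>simp add: n_def\<close>)
    then show ?thesis using that by (cases n) auto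
  qed
  ultimately show ?thesis by (intro exI[of _ n] conjI) blast+
qed

lemma dyadic_level_le:
  fixes y :: real
  assumes "1 / 2 ^ m \<le> y" "y < 2 / 2 ^ n"
  shows "n \<le> m"
proof (rule ccontr)
  assume "\<not> n \<le> m"
  then have "(2::real) ^ Suc m \<le> 2 ^ n" by (intro power_increasing) auto
  then have "2 / 2 ^ n \<le> 1 / (2::real) ^ m" by (simp add: field_simps)
  with assms show False by linarith
qed

lemma vnk_cell_exists:
  fixes x :: real
  assumes "x \<in> {0..<1}"
  obtains n where "n \<ge> 1" "x \<in> {1 - 2 / 2 ^ n ..< 1 - 1 / 2 ^ n}"
proof -
  define n where "n = (LEAST n. x < 1 - 1 / 2 ^ n)"
  have "\<exists>n. x < 1 - 1 / 2 ^ n"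
    using real_arch_pow_inv[of "1 - x" "1/2"] assms by (auto simp: power_divide algebra_simps)
  then have less: "x < 1 - 1 / 2 ^ n" unfolding n_def by (rule LeastI_ex)
  have n: "n \<noteq> 0"
  proof
    assume "n = 0"
    with less assms show False by simp
  qed
  have "\<not> x < 1 - 1 / 2 ^ (n - 1)"
    unfolding n_def by (rule not_less_Least) (use n in \<open>simp add: n_def\<close>)
  then have "1 - 2 / 2 ^ n \<le> x" using n by (cases n) auto
  with that[of n] less n show thesis by auto
qed

lemma bij_betw_von_neumann_kakutani:
  "bij_betw von_neumann_kakutani {0..<1} {0<..<1}"
  unfolding bij_betw_def
proof
  have cell: "\<exists>n\<ge>1. von_neumann_kakutani x = x - (1 - 3 / 2 ^ n) \<and>
      1 / 2 ^ n \<le> von_neumann_kakutani x \<and> von_neumann_kakutani x < 2 / 2 ^ n"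
    if x: "x \<in> {0..<1}" for x
  proof -
    obtain n where n: "n \<ge> 1" "x \<in> {1 - 2 / 2 ^ n ..< 1 - 1 / 2 ^ n}"
      using vnk_cell_exists[OF x] .
    with von_neumann_kakutani_eq[OF n] show ?thesis by (intro exI[of _ n]) auto
  qed
  show "inj_on von_neumann_kakutani {0..<1}"
  proof (rule inj_onI)
    fix x y :: real
    assume xy: "x \<in> {0..<1}" "y \<in> {0..<1}"
      and eq: "von_neumann_kakutani x = von_neumann_kakutani y"
    \<comment> \<open>The common value determines the index of the cell, hence the translation.\<close>
    from cell[OF xy(1)] cell[OF xy(2)] eq obtain n m where
      "von_neumann_kakutani x = x - (1 - 3 / 2 ^ n)" "von_neumann_kakutani y = y - (1 - 3 / 2 ^ m)"
      "n \<le> m" "m \<le> n"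
      by (metis dyadic_level_le)
    with eq show "x = y" by simp
  qed
  have "von_neumann_kakutani x \<in> {0<..<1}" if x: "x \<in> {0..<1}" for x
  proof -
    obtain n where n: "n \<ge> 1" "1 / 2 ^ n \<le> von_neumann_kakutani x"
      "von_neumann_kakutani x < 2 / 2 ^ n"
      using cell[OF x] by blast
    have "(0::real) < 1 / 2 ^ n" by simp
    moreover have "2 / 2 ^ n \<le> (1::real)" using n(1) self_le_power[of "2::real" n] by simp
    ultimately show ?thesis
      using n by (simp only: greaterThanLessThan_iff) linarith
  qed
  moreover have "y \<in> von_neumann_kakutani ` {0..<1}" if y: "y \<in> {0<..<1}" for y
  proof -
    obtain n where n: "1 / 2 ^ n \<le> y" "n = 0 \<or> y < 2 / 2 ^ n"
      using dyadic_level_below[of y] y by auto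
    with y have n': "n \<ge> 1" "y < 2 / 2 ^ n" by (cases n; auto)+
    define x where "x = y + (1 - 3 / 2 ^ n)"
    have x: "x \<in> {1 - 2 / 2 ^ n ..< 1 - 1 / 2 ^ n}" using n n' by (auto simp: x_def)
    have "2 / 2 ^ n \<le> (1::real)" using n'(1) self_le_power[of "2::real" n] by simp
    moreover have "(0::real) < 1 / 2 ^ n" by simp
    ultimately have "x \<in> {0..<1}"
      using x by (simp only: atLeastLessThan_iff) linarith
    moreover have "von_neumann_kakutani x = y"
      using von_neumann_kakutani_eq[OF n'(1) x] by (simp add: x_def)
    ultimately show ?thesis by blast
  qed
  ultimately show "von_neumann_kakutani ` {0..<1} = {0<..<1}" by blast
qed

lemma equal_cell_exists:
  fixes x :: real
  assumes "q > 0" "x \<in> {0..<1}"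
  obtains i where "i < q" "x \<in> {real i / real q ..< (real i + 1) / real q}"
proof -
  define i where "i = nat \<lfloor>real q * x\<rfloor>"
  have "real i = of_int \<lfloor>real q * x\<rfloor>"
    using assms(2) by (simp add: i_def)
  then have ge: "real i \<le> real q * x" "real q * x < real i + 1"
    by linarith+
  have "real q * x < real q * 1" using assms by (intro mult_strict_left_mono) auto
  with ge have "i < q" by linarith
  with ge assms show thesis by (intro that[of i]) (auto simp: field_simps)
qed

lemma equal_cell_unique:
  fixes x :: real
  assumes "q > 0" "x \<in> {real i / real q ..< (real i + 1) / real q}"
    "x \<in> {real j / real q ..< (real j + 1) / real q}"
  shows "i = j"
proof -
  have "real i < real j + 1" "real j < real i + 1"
    using assms by (auto simp: field_simps)
  then show ?thesis by linarith
qed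

lemma bij_betw_interval_perm:
  assumes q: "q > 0" and \<pi>: "\<pi> permutes {..<q}"
  shows "bij_betw (interval_perm q \<pi>) {0..<1} {0..<1}"
  unfolding bij_betw_def
proof
  have cell: "\<exists>i<q. interval_perm q \<pi> x = x + (real (\<pi> i) / real q - real i / real q) \<and>
      interval_perm q \<pi> x \<in> {real (\<pi> i) / real q ..< (real (\<pi> i) + 1) / real q}"
    if x: "x \<in> {0..<1}" for x
  proof -
    obtain i where i: "i < q" "x \<in> {real i / real q ..< (real i + 1) / real q}"
      using equal_cell_exists[OF q x] .
    with interval_perm_eq[OF i, of \<pi>] show ?thesis
      by (intro exI[of _ i]) (auto simp: add_divide_distrib)
  qed
  have sub: "{real i / real q ..< (real i + 1) / real q} \<subseteq> {0..<1}" if "i < q" for i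
  proof -
    have "(real i + 1) / real q \<le> 1" using that by simp
    then show ?thesis by auto
  qed
  show "inj_on (interval_perm q \<pi>) {0..<1}"
  proof (rule inj_onI)
    fix x y :: real
    assume xy: "x \<in> {0..<1}" "y \<in> {0..<1}" and eq: "interval_perm q \<pi> x = interval_perm q \<pi> y"
    from cell[OF xy(1)] cell[OF xy(2)] eq obtain i j where
      ij: "interval_perm q \<pi> x = x + (real (\<pi> i) / real q - real i / real q)"
        "interval_perm q \<pi> y = y + (real (\<pi> j) / real q - real j / real q)"
        "\<pi> i = \<pi> j"
      by (metis equal_cell_unique[OF q])
    then have "i = j" using permutes_inj[OF \<pi>] by (simp add: inj_eq)
    with eq ij show "x = y" by simp
  qed
  have "interval_perm q \<pi> x \<in> {0..<1}" if x: "x \<in> {0..<1}" for x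
    using cell[OF x] sub permutes_in_image[OF \<pi>] by blast
  moreover have "y \<in> interval_perm q \<pi> ` {0..<1}" if y: "y \<in> {0..<1}" for y
  proof -
    obtain j where j: "j < q" "y \<in> {real j / real q ..< (real j + 1) / real q}"
      using equal_cell_exists[OF q y] .
    obtain i where i: "i < q" "\<pi> i = j"
      using j(1) permutes_image[OF \<pi>] by (metis imageE lessThan_iff)
    define x where "x = y - (real j / real q - real i / real q)"
    have x: "x \<in> {real i / real q ..< (real i + 1) / real q}"
      using j by (auto simp: x_def add_divide_distrib)
    have "interval_perm q \<pi> x = y"
      using interval_perm_eq[OF i(1) x, of \<pi>] i(2) by (simp add: x_def)
    with x sub[OF i(1)] show ?thesis by blast
  qed
  ultimately show "interval_perm q \<pi> ` {0..<1} = {0..<1}" by blast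
qed

lemma bij_betw_rotated_odometer:
  assumes "q > 0" "\<pi> permutes {..<q}"
  shows "bij_betw (rotated_odometer q \<pi>) {0..<1} {0<..<1}"
  unfolding rotated_odometer_def
  by (rule bij_betw_trans[OF bij_betw_interval_perm[OF assms] bij_betw_von_neumann_kakutani])

section \<open>Intervals of periodic points\<close>

text \<open>The bound \<open>e\<close> depends on \<open>x\<close> because the pieces of \<open>von_neumann_kakutani\<close> become arbitrarily short
  near \<open>1\<close>.\<close>

definition right_translation :: "(real \<Rightarrow> real) \<Rightarrow> bool" where
  "right_translation f \<longleftrightarrow>
     (\<forall>x\<in>{0..<1}. \<exists>e>0. \<forall>y\<in>{x..<x + e}. y \<in> {0..<1} \<and> f y = f x + (y - x))"

lemma right_translationI:
  assumes "\<And>x. x \<in> {0..<1} \<Longrightarrow>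
    \<exists>b c. x < b \<and> b \<le> 1 \<and> (\<forall>y\<in>{x..<b}. f y = y + c)"
  shows "right_translation f"
  unfolding right_translation_def
proof
  fix x :: real assume x: "x \<in> {0..<1}"
  obtain b c where "x < b" "b \<le> 1" "\<forall>y\<in>{x..<b}. f y = y + c"
    using assms[OF x] by blast
  with x show "\<exists>e>0. \<forall>y\<in>{x..<x + e}. y \<in> {0..<1} \<and> f y = f x + (y - x)"
    by (intro exI[of _ "b - x"]) auto
qed

lemma right_translation_comp:
  assumes f: "right_translation f" and g: "right_translation g" and maps: "f ` {0..<1} \<subseteq> {0..<1}"
  shows "right_translation (g \<circ> f)"
  unfolding right_translation_def
proof
  fix x :: real assume x: "x \<in> {0..<1}"
  then obtain d where d: "d > 0" "\<And>y. y \<in> {x..<x + d} \<Longrightarrow> y \<in> {0..<1} \<and> f y = f x + (y - x)"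
    using bspec[OF f[unfolded right_translation_def] x] by blast
  have fx: "f x \<in> {0..<1}" using x maps by blast
  obtain e where e: "e > 0"
    "\<And>z. z \<in> {f x..<f x + e} \<Longrightarrow> g z = g (f x) + (z - f x)"
    using bspec[OF g[unfolded right_translation_def] fx] by blast
  have "y \<in> {0..<1} \<and> (g \<circ> f) y = (g \<circ> f) x + (y - x)" if y: "y \<in> {x..<x + min d e}" for y
    using d(2)[of y] e(2)[of "f y"] y by auto
  moreover have "min d e > 0" using d(1) e(1) by simp
  ultimately show "\<exists>e>0. \<forall>y\<in>{x..<x + e}. y \<in> {0..<1} \<and> (g \<circ> f) y = (g \<circ> f) x + (y - x)"
    by blast
qed

lemma right_translation_funpow:
  assumes "right_translation f" "f ` {0..<1} \<subseteq> {0..<1}"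
  shows "right_translation (f ^^ n)"
proof (induction n)
  case 0
  show ?case by (rule right_translationI, rule exI[of _ 1], rule exI[of _ 0]) simp
next
  case (Suc n)
  have "(f ^^ n) ` {0..<1} \<subseteq> {0..<1}" using funpow_in_set[OF assms(2)] by blast
  then show ?case using right_translation_comp[OF Suc assms(1)] by (simp only: funpow.simps)
qed

lemma right_translation_von_neumann_kakutani: "right_translation von_neumann_kakutani"
proof (rule right_translationI)
  fix x :: real assume "x \<in> {0..<1}"
  then obtain n where n: "n \<ge> 1" "x \<in> {1 - 2 / 2 ^ n ..< 1 - 1 / 2 ^ n}"
    using vnk_cell_exists by blast
  have "von_neumann_kakutani y = y + (- (1 - 3 / 2 ^ n))" if "y \<in> {x..<1 - 1 / 2 ^ n}" for y
    using von_neumann_kakutani_eq[OF n(1), of y] n(2) that by simp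
  then show "\<exists>b c. x < b \<and> b \<le> 1 \<and> (\<forall>y\<in>{x..<b}. von_neumann_kakutani y = y + c)"
    using n(2) by (intro exI[of _ "1 - 1 / 2 ^ n"] exI[of _ "- (1 - 3 / 2 ^ n)"]) auto
qed

lemma right_translation_interval_perm:
  assumes "q > 0"
  shows "right_translation (interval_perm q \<pi>)"
proof (rule right_translationI)
  fix x :: real assume "x \<in> {0..<1}"
  then obtain i where i: "i < q" "x \<in> {real i / real q ..< (real i + 1) / real q}"
    using equal_cell_exists[OF assms] by blast
  have "interval_perm q \<pi> y = y + (real (\<pi> i) / real q - real i / real q)"
    if "y \<in> {x..<(real i + 1) / real q}" for y
    using interval_perm_eq[OF i(1), of y \<pi>] i(2) that by simp
  then show "\<exists>b c. x < b \<and> b \<le> 1 \<and> (\<forall>y\<in>{x..<b}. interval_perm q \<pi> y = y + c)"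
    using i by (intro exI[of _ "(real i + 1) / real q"]
        exI[of _ "real (\<pi> i) / real q - real i / real q"]) auto
qed

lemma right_translation_rotated_odometer:
  assumes "q > 0" "\<pi> permutes {..<q}"
  shows "right_translation (rotated_odometer q \<pi>)"
  unfolding rotated_odometer_def
proof (rule right_translation_comp)
  show "interval_perm q \<pi> ` {0..<1} \<subseteq> {0..<1}"
    using bij_betw_interval_perm[OF assms] by (simp add: bij_betw_def)
qed (rule right_translation_interval_perm[OF assms(1)] right_translation_von_neumann_kakutani)+

text \<open>If \<open>f ^^ n\<close> fixes \<open>x\<close>, it is a translation by \<open>0\<close> on an interval that starts at \<open>x\<close>, and all
  points of this interval have the period \<open>n\<close> as well.\<close>

lemma periodic_points_Union_intervals:
  assumes f: "right_translation f" "f ` {0..<1} \<subseteq> {0..<1}"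
  defines "P \<equiv> {x \<in> {0..<1}. \<exists>n\<ge>1. (f ^^ n) x = x}"
  shows "\<exists>\<J>. (\<forall>J\<in>\<J>. \<exists>x y. x < y \<and> J = {x..<y}) \<and> P = \<Union>\<J>"
proof -
  define \<J> where "\<J> = {{x..<y} | x y. x < y \<and> {x..<y} \<subseteq> P}"
  have "x \<in> \<Union>\<J>" if x: "x \<in> P" for x
  proof -
    obtain n where n: "n \<ge> 1" "(f ^^ n) x = x" and xI: "x \<in> {0..<1}"
      using x unfolding P_def by blast
    obtain e where e: "e > 0"
      "\<forall>y\<in>{x..<x + e}. y \<in> {0..<1} \<and> (f ^^ n) y = (f ^^ n) x + (y - x)"
      using bspec[OF right_translation_funpow[OF f, of n, unfolded right_translation_def] xI]
      by blast
    have "{x..<x + e} \<subseteq> P"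
    proof
      fix y assume "y \<in> {x..<x + e}"
      from bspec[OF e(2) this] n(2) have "y \<in> {0..<1}" "(f ^^ n) y = y" by simp_all
      with n(1) show "y \<in> P" unfolding P_def by blast
    qed
    moreover have "x < x + e" using e(1) by simp
    ultimately have "{x..<x + e} \<in> \<J>"
      unfolding \<J>_def by (intro CollectI exI[of _ x] exI[of _ "x + e"]) simp
    then show ?thesis using e(1) by (intro UnionI[of "{x..<x + e}"]) simp_all
  qed
  then have "P \<subseteq> \<Union>\<J>" by blast
  moreover have "\<Union>\<J> \<subseteq> P" by (auto simp: \<J>_def)
  moreover have "\<forall>J\<in>\<J>. \<exists>x y. x < y \<and> J = {x..<y}" by (auto simp: \<J>_def)
  ultimately show ?thesis by (intro exI[of _ \<J>] conjI equalityI)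
qed

section \<open>Non-periodic orbits accumulate at zero\<close>

lemma finite_bounded_lattice_coset:
  fixes x h a b :: real
  assumes "h > 0"
  shows "finite ((\<lambda>k::int. x + of_int k * h) -` {a..b})"
proof (rule finite_subset)
  show "(\<lambda>k::int. x + of_int k * h) -` {a..b} \<subseteq> {\<lfloor>(a - x) / h\<rfloor>..\<lceil>(b - x) / h\<rceil>}"
  proof
    fix k :: int assume "k \<in> (\<lambda>k::int. x + of_int k * h) -` {a..b}"
    then have "(a - x) / h \<le> of_int k" "of_int k \<le> (b - x) / h"
      using assms by (auto simp: field_simps)
    then show "k \<in> {\<lfloor>(a - x) / h\<rfloor>..\<lceil>(b - x) / h\<rceil>}"
      by (simp add: floor_le_iff le_ceiling_iff)
  qed
qed simp

text \<open>Large values of \<open>F\<close> come from early cells of the odometer: a value of at least \<open>1/2^N\<close> excludes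
  every cell of index above \<open>N\<close>, and the first \<open>N\<close> cells are translated by multiples of \<open>1/2^N\<close>.\<close>

lemma rotated_odometer_lattice_step:
  assumes q: "q > 0" and \<pi>: "\<pi> permutes {..<q}" and x: "x \<in> {0..<1}"
    and ge: "rotated_odometer q \<pi> x \<ge> 1 / 2 ^ N"
  shows "\<exists>k::int. rotated_odometer q \<pi> x = x + of_int k * (1 / (real q * 2 ^ N))"
proof -
  obtain i where i: "i < q" "x \<in> {real i / real q ..< (real i + 1) / real q}"
    using equal_cell_exists[OF q x] .
  define z where "z = interval_perm q \<pi> x"
  have z: "z = x + (real (\<pi> i) / real q - real i / real q)"
    unfolding z_def by (rule interval_perm_eq[OF i])
  have "z \<in> {0..<1}"
    unfolding z_def using bij_betw_apply[OF bij_betw_interval_perm[OF q \<pi>] x] .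
  then obtain n where n: "n \<ge> 1" "z \<in> {1 - 2 / 2 ^ n ..< 1 - 1 / 2 ^ n}"
    using vnk_cell_exists by blast
  have Fx: "rotated_odometer q \<pi> x = z - (1 - 3 / 2 ^ n)"
    using von_neumann_kakutani_eq[OF n] by (simp add: rotated_odometer_def z_def)
  have "rotated_odometer q \<pi> x < 2 / 2 ^ n" using n(2) by (simp add: Fx)
  with ge have "n \<le> N" by (rule dyadic_level_le)
  then have N: "(2::real) ^ N = 2 ^ n * 2 ^ (N - n)" by (simp flip: power_add)
  \<comment> \<open>The total translation \<open>(\<pi> i - i)/q - (1 - 3/2^n)\<close>, in units of \<open>1/(q 2^N)\<close>.\<close>
  define k :: int where
    "k = (int (\<pi> i) - int i) * 2 ^ N - int q * (2 ^ N - 3 * 2 ^ (N - n))"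
  have "rotated_odometer q \<pi> x = x + of_int k * (1 / (real q * 2 ^ N))"
    unfolding Fx z k_def using q by (simp add: N field_simps)
  then show ?thesis by blast
qed

text \<open>An orbit bounded away from \<open>0\<close> makes lattice steps only. It stays in a bounded part of one coset
  of a lattice, so it is finite and therefore periodic.\<close>

lemma nonperiodic_orbit_near_0:
  assumes q: "q > 0" and \<pi>: "\<pi> permutes {..<q}"
    and x: "x \<in> I_np q \<pi>" and e: "e > 0"
  shows "\<exists>n. (rotated_odometer q \<pi> ^^ n) x < e"
proof (rule ccontr)
  let ?F = "rotated_odometer q \<pi>"
  assume "\<not> ?thesis"
  then have far: "(?F ^^ n) x \<ge> e" for n by (meson not_le)
  have bij: "bij_betw ?F {0..<1} {0<..<1}" by (rule bij_betw_rotated_odometer[OF q \<pi>])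
  then have maps: "?F ` {0..<1} \<subseteq> {0..<1}"
    using greaterThanLessThan_subseteq_atLeastLessThan_iff[of 0 1 0 "1::real"]
    by (simp add: bij_betw_def)
  have xI: "x \<in> {0..<1}" using x by (simp add: I_np_def)
  obtain N where N: "1 / 2 ^ N < e"
    using real_arch_pow_inv[OF e, of "1/2"] by (auto simp: power_divide)
  define h where "h = 1 / (real q * 2 ^ N)"
  have h: "h > 0" using q by (simp add: h_def)
  have lattice: "\<exists>k::int. (?F ^^ n) x = x + of_int k * h" for n
  proof (induction n)
    case 0
    show ?case by (rule exI[of _ 0]) simp
  next
    case (Suc n)
    then obtain k :: int where k: "(?F ^^ n) x = x + of_int k * h" by blast
    have "?F ((?F ^^ n) x) \<ge> 1 / 2 ^ N" using far[of "Suc n"] N by simp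
    from rotated_odometer_lattice_step[OF q \<pi> funpow_in_set[OF maps xI] this]
    obtain l :: int where "(?F ^^ Suc n) x = (?F ^^ n) x + of_int l * h"
      unfolding h_def by auto
    with k show ?case by (intro exI[of _ "k + l"]) (simp add: algebra_simps)
  qed
  let ?c = "\<lambda>k::int. x + of_int k * h"
  have "range (\<lambda>n. (?F ^^ n) x) \<subseteq> ?c ` (?c -` {0..1})"
  proof safe
    fix n
    obtain k :: int where k: "(?F ^^ n) x = ?c k" using lattice by blast
    moreover have "(?F ^^ n) x \<in> {0..1}" using funpow_in_set[OF maps xI, of n] by auto
    ultimately show "(?F ^^ n) x \<in> ?c ` (?c -` {0..1})" by auto
  qed
  then have "finite (range (\<lambda>n. (?F ^^ n) x))"
    using finite_bounded_lattice_coset[OF h] finite_subset by blast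
  then have "\<exists>n\<ge>1. (?F ^^ n) x = x"
    by (rule periodic_if_finite_orbit[OF bij_betw_imp_inj_on[OF bij] maps xI])
  then show False using x by (auto simp: I_np_def I_per_def)
qed

section \<open>Minimal subsystems\<close>

lemma subsystem_funpow:
  assumes "subsystem X f M" "x \<in> M"
  shows "(f ^^ n) x \<in> M"
  using assms funpow_in_set[of f M] by (simp add: subsystem_def)

text \<open>Closedness and invariance survive arbitrary intersections; a common point also keeps the
  intersection of all subsystems non-empty. It is then the least subsystem.\<close>

lemma unique_minimal_subsystem:
  assumes X: "p \<in> X" "f ` X \<subseteq> X" and common: "\<And>M. subsystem X f M \<Longrightarrow> p \<in> M"
  shows "\<exists>K. minimal_subsystem X f K \<and> p \<in> K \<and> (\<forall>M. minimal_subsystem X f M \<longrightarrow> M = K)"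
proof -
  define K where "K = \<Inter>{M. subsystem X f M}"
  have whole: "subsystem X f X" using X by (auto simp: subsystem_def)
  have p: "p \<in> K" using common by (auto simp: K_def)
  have "closedin (top_of_set X) K"
    unfolding K_def
  proof (rule closedin_Inter)
    show "{M. subsystem X f M} \<noteq> {}" using whole by blast
  qed (simp add: subsystem_def)
  moreover have "K \<subseteq> X" using whole by (auto simp: K_def)
  moreover have "f ` K \<subseteq> K" by (auto simp: K_def subsystem_def)
  ultimately have K: "subsystem X f K" using p by (auto simp: subsystem_def)
  have least: "K \<subseteq> M" if "subsystem X f M" for M using that by (auto simp: K_def)
  have "minimal_subsystem X f K" using K least by (auto simp: minimal_subsystem_def)
  moreover have "M = K" if "minimal_subsystem X f M" for M
    using that K least unfolding minimal_subsystem_def by blast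
  ultimately show ?thesis using p by blast
qed

text \<open>A subsystem contains an orbit that accumulates at \<open>0\<close>. It is closed only relative to the
  non-periodic part, and this is where \<open>0\<close> has to be non-periodic itself.\<close>

lemma subsystem_contains_0:
  assumes q: "q > 0" and \<pi>: "\<pi> permutes {..<q}" and zero: "0 \<in> I_np q \<pi>"
    and M: "subsystem (I_np q \<pi>) (rotated_odometer q \<pi>) M"
  shows "0 \<in> M"
proof -
  obtain x where x: "x \<in> M" "x \<in> I_np q \<pi>" using M by (auto simp: subsystem_def)
  obtain C where C: "closed C" "M = I_np q \<pi> \<inter> C"
    using M by (auto simp: subsystem_def closedin_closed)
  have "0 \<in> closure M"
    unfolding closure_approachable
  proof (intro allI impI)
    fix e :: real assume "e > 0"
    then obtain n where n: "(rotated_odometer q \<pi> ^^ n) x < e"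
      using nonperiodic_orbit_near_0[OF q \<pi> x(2)] by blast
    have "(rotated_odometer q \<pi> ^^ n) x \<in> M" using subsystem_funpow[OF M x(1)] .
    moreover from this have "(rotated_odometer q \<pi> ^^ n) x \<ge> 0"
      using M by (auto simp: subsystem_def I_np_def)
    ultimately show "\<exists>y\<in>M. dist y 0 < e" using n by (intro bexI) simp_all
  qed
  then have "0 \<in> C" using C closure_minimal[of M C] by blast
  with zero C show ?thesis by blast
qed

section \<open>The decomposition\<close>


theorem theorem1p2:
  fixes q :: nat and \<pi> :: "nat \<Rightarrow> nat"
  assumes "q \<ge> 2" and "\<pi> permutes {..<q}"
  defines "F \<equiv> rotated_odometer q \<pi>"
  shows
    "{0..<1} = I_per q \<pi> \<union> I_np q \<pi> \<and> I_per q \<pi> \<inter> I_np q \<pi> = {} \<and>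
     ((\<forall>x \<in> I_per q \<pi>. \<exists>n\<ge>1. (F ^^ n) x = x) \<and>
       F ` I_per q \<pi> \<subseteq> I_per q \<pi> \<and> bij_betw F (I_per q \<pi>) (I_per q \<pi>)) \<and>
     (I_per q \<pi> \<noteq> {} \<longrightarrow>
       (\<exists>\<J>. (\<forall>J\<in>\<J>. \<exists>x y. x < y \<and> J = {x..<y}) \<and> I_per q \<pi> = \<Union>\<J>)) \<and>
     (0 \<in> I_np q \<pi> \<and> F ` I_np q \<pi> \<subseteq> I_np q \<pi> \<and>
       (\<forall>y \<in> I_np q \<pi> - {0}. \<exists>!x. x \<in> I_np q \<pi> \<and> F x = y)) \<and>
     (\<exists>I_min. minimal_subsystem (I_np q \<pi>) F I_min \<and> 0 \<in> I_min \<and>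
       (\<forall>M. minimal_subsystem (I_np q \<pi>) F M \<longrightarrow> M = I_min))"
proof -
  have q: "q > 0" using assms(1) by simp
  note \<pi> = assms(2)
  have bij: "bij_betw F {0..<1} {0<..<1}"
    unfolding F_def by (rule bij_betw_rotated_odometer[OF q \<pi>])
  then have inj: "inj_on F {0..<1}" and range: "F ` {0..<1} = {0<..<1}"
    by (auto simp: bij_betw_def)
  then have maps: "F ` {0..<1} \<subseteq> {0..<1}" by auto
  have per: "I_per q \<pi> = {x \<in> {0..<1}. \<exists>n\<ge>1. (F ^^ n) x = x}"
    by (simp add: I_per_def F_def)
  have per_image: "F x \<in> I_per q \<pi> \<longleftrightarrow> x \<in> I_per q \<pi>" if x: "x \<in> {0..<1}" for x
  proof -
    have "F x \<in> {0..<1}" using x maps by blast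
    with x show ?thesis by (simp add: per periodic_image_iff[OF inj maps x])
  qed
  have bij_per: "bij_betw F (I_per q \<pi>) (I_per q \<pi>)"
    unfolding per by (rule bij_betw_periodic_points[OF inj maps])
  \<comment> \<open>A periodic point is a value of \<open>F\<close>, but \<open>0\<close> is not.\<close>
  have "0 \<notin> F ` {0..<1}" by (simp add: range)
  moreover have "I_per q \<pi> \<subseteq> F ` {0..<1}"
  proof -
    have "I_per q \<pi> \<subseteq> {0..<1}" by (auto simp: per)
    with bij_betw_imp_surj_on[OF bij_per] show ?thesis by blast
  qed
  ultimately have zero: "0 \<in> I_np q \<pi>" by (auto simp: I_np_def)
  have np_maps: "F ` I_np q \<pi> \<subseteq> I_np q \<pi>"
    using maps per_image by (auto simp: I_np_def)
  have np_inv: "\<exists>!x. x \<in> I_np q \<pi> \<and> F x = y" if y: "y \<in> I_np q \<pi> - {0}" for y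
  proof -
    have "y \<in> F ` {0..<1}" using y by (auto simp: range I_np_def)
    then obtain x where x: "x \<in> {0..<1}" "F x = y" by blast
    show ?thesis
    proof (rule ex1I[of _ x])
      show "x \<in> I_np q \<pi> \<and> F x = y" using x y per_image by (auto simp: I_np_def)
      show "x' = x" if "x' \<in> I_np q \<pi> \<and> F x' = y" for x'
        using that x inj by (auto simp: I_np_def inj_on_def)
    qed
  qed
  have intervals: "\<exists>\<J>. (\<forall>J\<in>\<J>. \<exists>x y. x < y \<and> J = {x..<y}) \<and> I_per q \<pi> = \<Union>\<J>"
    unfolding per using right_translation_rotated_odometer[OF q \<pi>] maps
    by (intro periodic_points_Union_intervals) (simp_all add: F_def)
  have minimal: "\<exists>K. minimal_subsystem (I_np q \<pi>) F K \<and> 0 \<in> K \<and>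
      (\<forall>M. minimal_subsystem (I_np q \<pi>) F M \<longrightarrow> M = K)"
    using subsystem_contains_0[OF q \<pi> zero] unfolding F_def[symmetric]
    by (intro unique_minimal_subsystem[OF zero np_maps])
  have "{0..<1} = I_per q \<pi> \<union> I_np q \<pi>" "I_per q \<pi> \<inter> I_np q \<pi> = {}"
    by (auto simp: I_np_def per)
  moreover have "\<forall>x\<in>I_per q \<pi>. \<exists>n\<ge>1. (F ^^ n) x = x" by (simp add: per)
  moreover have "F ` I_per q \<pi> \<subseteq> I_per q \<pi>" using bij_per by (simp add: bij_betw_def)
  ultimately show ?thesis
    using bij_per zero np_maps np_inv intervals minimal by (intro conjI impI ballI) simp_all
qed

end
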